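(* Let $n_1,n_2,n_3$ be integers with $n_3\geq n_2\geq n_1\geq 3$. Then the generalized Hamming graph $HG(n_1,n_2,n_3;3)$ cannot be resolved with fewer than $2n_3-1$ landmarks; that is, every resolving set $W$ of $HG(n_1,n_2,n_3;3)$ satisfies $|W|\geq 2n_3-1$.
   Context: For positive integers $n_1,n_2,n_3$, write $[n]=\{1,2,\ldots,n\}$. The generalized Hamming graph $HG(n_1,n_2,n_3;3)$ is the simple graph with vertex set $[n_1]\times[n_2]\times[n_3]$ in which two vertices $(x_1,x_2,x_3)$ and $(y_1,y_2,y_3)$ are adjacent if and only if they differ in all three coordinates, i.e. $x_i\neq y_i$ for $i=1,2,3$. When all $n_i\geq 3$ this graph is connected (of diameter two). For a finite connected graph $G$ with vertex set $V$, let $d(x,y)$ denote the length of a shortest path between $x$ and $y$. A subset $W\subseteq V$, whose elements are called landmarks, is a resolving set for $G$ (or $W$ resolves $G$) if for every pair of distinct vertices $x,y\in V-W$ there exists $w\in W$ such that $d(x,w)\neq d(y,w)$. *)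

theory Defs
  imports "Graph_Theory.Graph_Theory"
begin

text \<open>Simple graphs are symmetric loop-free digraphs, as in \<^theory>\<open>Graph_Theory.Digraph\<close>: an
  undirected edge is represented by its two opposite arcs.\<close>

definition HG3 :: "nat \<Rightarrow> nat \<Rightarrow> nat \<Rightarrow> (nat \<times> nat \<times> nat) pair_pre_digraph" where
  "HG3 n1 n2 n3 =
     \<lparr> pverts = {1..n1} \<times> {1..n2} \<times> {1..n3},
       parcs = {((x1, x2, x3), (y1, y2, y3)) | x1 x2 x3 y1 y2 y3.
                  (x1, x2, x3) \<in> {1..n1} \<times> {1..n2} \<times> {1..n3} \<and>
                  (y1, y2, y3) \<in> {1..n1} \<times> {1..n2} \<times> {1..n3} \<and>
                  x1 \<noteq> y1 \<and> x2 \<noteq> y2 \<and> x3 \<noteq> y3} \<rparr>"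

text \<open>The distance is the minimal cost of a walk when every arc costs 1. It takes values in
  \<^typ>\<open>ereal\<close> and is infinite when there is no walk.\<close>

definition graph_dist :: "('a, 'b) pre_digraph \<Rightarrow> 'a \<Rightarrow> 'a \<Rightarrow> ereal" where
  "graph_dist G x y = wf_digraph.\<mu> G (\<lambda>_. 1) x y"

text \<open>Only vertices outside the set have to be separated.\<close>

definition resolving_set :: "('a, 'b) pre_digraph \<Rightarrow> 'a set \<Rightarrow> bool" where
  "resolving_set G W \<longleftrightarrow>
     W \<subseteq> verts G \<and>
     (\<forall>x \<in> verts G - W. \<forall>y \<in> verts G - W. x \<noteq> y \<longrightarrow>
        (\<exists>w \<in> W. graph_dist G x w \<noteq> graph_dist G y w))"

lemma pair_graph_HG3: "pair_graph (HG3 n1 n2 n3)"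
proof unfold_locales
  let ?V = "pverts (HG3 n1 n2 n3)"
  have "parcs (HG3 n1 n2 n3) \<subseteq> ?V \<times> ?V" "finite ?V"
    by (auto simp: HG3_def)
  then show "finite (parcs (HG3 n1 n2 n3))"
    by (meson finite_SigmaI finite_subset)
  show "symmetric (HG3 n1 n2 n3)"
    unfolding symmetric_def by (rule symI) (auto simp: HG3_def)
qed (auto simp: HG3_def)

lemma avoid_two:
  fixes a b n :: nat
  assumes "3 \<le> n"
  obtains c where "c \<in> {1..n}" "c \<noteq> a" "c \<noteq> b"
proof -
  have "card {a, b} < card {1..n}"
    using assms by (auto simp: card_insert_if)
  then have "\<not> {1..n} \<subseteq> {a, b}"
    by (meson card_mono finite.emptyI finite_insert not_le)
  then obtain c where "c \<in> {1..n}" "c \<notin> {a, b}" by blast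
  then show thesis by (intro that[of c]) auto
qed

lemma connected_HG3:
  assumes "3 \<le> n1" "3 \<le> n2" "3 \<le> n3"
  shows "connected (HG3 n1 n2 n3)"
proof -
  interpret pair_graph "HG3 n1 n2 n3" by (rule pair_graph_HG3)
  have reach: "u \<rightarrow>\<^sup>*\<^bsub>with_proj (HG3 n1 n2 n3)\<^esub> v"
    if "u \<in> pverts (HG3 n1 n2 n3)" "v \<in> pverts (HG3 n1 n2 n3)" for u v
  proof -
    obtain u1 u2 u3 v1 v2 v3 where uv: "u = (u1, u2, u3)" "v = (v1, v2, v3)"
      by (metis prod_cases3)
    obtain z1 where z1: "z1 \<in> {1..n1}" "z1 \<noteq> u1" "z1 \<noteq> v1" using avoid_two[OF assms(1)] .
    obtain z2 where z2: "z2 \<in> {1..n2}" "z2 \<noteq> u2" "z2 \<noteq> v2" using avoid_two[OF assms(2)] .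
    obtain z3 where z3: "z3 \<in> {1..n3}" "z3 \<noteq> u3" "z3 \<noteq> v3" using avoid_two[OF assms(3)] .
    have "(u, (z1, z2, z3)) \<in> parcs (HG3 n1 n2 n3)" "((z1, z2, z3), v) \<in> parcs (HG3 n1 n2 n3)"
      using that z1 z2 z3 by (auto simp: HG3_def uv)
    then show ?thesis
      by (meson reachable_adjI reachable_trans)
  qed
  have "(1, 1, 1) \<in> pverts (HG3 n1 n2 n3)"
    using assms by (auto simp: HG3_def)
  moreover have "(u, v) \<in> rtrancl_on (pverts (HG3 n1 n2 n3)) ((parcs (HG3 n1 n2 n3))\<^sup>s)"
    if "u \<in> pverts (HG3 n1 n2 n3)" "v \<in> pverts (HG3 n1 n2 n3)" for u v
    using reach[OF that] by (auto simp: reachable_def symcl_def elim!: rtrancl_on_mono[rotated -1])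
  ultimately show ?thesis by (auto simp: connected_conv)
qed

end

theory Submission
  imports Defs
begin

text \<open>Slice the vertex set into the layers where the third coordinate takes a fixed value. The
  bound comes from comparing two layers: any two of them together contain at least three
  landmarks.

  Since the graph has diameter two, a landmark separates two other vertices exactly when it is
  adjacent to one of them and not to the other (\<open>HG3_graph_dist\<close>). Compare vertices
  \<open>(a, b, c)\<close> and \<open>(a, b, d)\<close>. A landmark outside the layers \<open>c\<close> and \<open>d\<close> treats them alike; a
  landmark \<open>(p, q, c)\<close> or \<open>(p, q, d)\<close> misses the vertex of its own layer, so it separates them only
  if it sees the other one, that is, only if \<open>p \<noteq> a\<close> and \<open>q \<noteq> b\<close>. If the two layers hold at
  most two landmarks, project them to the grid of the first two coordinates: some point
  \<open>(a, b)\<close> outside the projection agrees with each projected landmark in a coordinate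
  (\<open>two_points_blocked\<close>), so the pair is unresolved. This is \<open>two_layers_card_ge_3\<close>.

  It remains to count: the layer sizes are natural numbers with pairwise sums at least three.
  Either all are at least two, or one of them is at most one and forces the others up
  (\<open>sum_ge_if_pairs_ge_3\<close>). The extremal shape is one layer with a single landmark and two
  landmarks in every other layer. The slicing direction is arbitrary; the third coordinate gives
  the best bound because \<open>n3\<close> is the largest.\<close>

text \<open>Three values in each coordinate leave room to avoid the coordinates of both endpoints, so
  distinct nonadjacent vertices have a common neighbour.\<close>

lemma HG3_graph_dist:
  assumes "3 \<le> n1" "3 \<le> n2" "3 \<le> n3"
    and x: "x \<in> pverts (HG3 n1 n2 n3)" and w: "w \<in> pverts (HG3 n1 n2 n3)" and "x \<noteq> w"
  shows "graph_dist (with_proj (HG3 n1 n2 n3)) x w =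
    (if (x, w) \<in> parcs (HG3 n1 n2 n3) then 1 else 2)"
proof -
  interpret pair_graph "HG3 n1 n2 n3" by (rule pair_graph_HG3)
  let ?G = "with_proj (HG3 n1 n2 n3)"
  have dist: "graph_dist ?G x w = (INF p \<in> {p. awalk x p w}. ereal (real (length p)))"
    by (simp add: graph_dist_def \<mu>_def awalk_cost_def sum_list_triv)
  show ?thesis
  proof (cases "(x, w) \<in> parcs (HG3 n1 n2 n3)")
    case True
    have "awalk x [(x, w)] w" using arc_implies_awalk[of "(x, w)"] True by simp
    then have "graph_dist ?G x w \<le> 1" unfolding dist by (intro INF_lower2[of "[(x, w)]"]) auto
    moreover have "1 \<le> ereal (real (length p))" if "awalk x p w" for p
    proof -
      have "p \<noteq> []" using that \<open>x \<noteq> w\<close> by (auto simp: awalk_Nil_iff)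
      then show ?thesis by (cases p) auto
    qed
    then have "1 \<le> graph_dist ?G x w" unfolding dist by (intro INF_greatest) auto
    ultimately show ?thesis using True by auto
  next
    case False
    obtain x1 x2 x3 w1 w2 w3 where xw: "x = (x1, x2, x3)" "w = (w1, w2, w3)"
      by (metis prod_cases3)
    obtain z1 where z1: "z1 \<in> {1..n1}" "z1 \<noteq> x1" "z1 \<noteq> w1" using avoid_two[OF assms(1)] .
    obtain z2 where z2: "z2 \<in> {1..n2}" "z2 \<noteq> x2" "z2 \<noteq> w2" using avoid_two[OF assms(2)] .
    obtain z3 where z3: "z3 \<in> {1..n3}" "z3 \<noteq> x3" "z3 \<noteq> w3" using avoid_two[OF assms(3)] .
    let ?z = "(z1, z2, z3)"
    have "(x, ?z) \<in> parcs (HG3 n1 n2 n3)" "(?z, w) \<in> parcs (HG3 n1 n2 n3)"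
      using x w z1 z2 z3 by (auto simp: HG3_def xw)
    then have "awalk x [(x, ?z), (?z, w)] w"
      using x w by (auto simp: awalk_Cons_iff awalk_Nil_iff)
    then have "graph_dist ?G x w \<le> 2"
      unfolding dist by (intro INF_lower2[of "[(x, ?z), (?z, w)]"]) auto
    moreover have "2 \<le> ereal (real (length p))" if "awalk x p w" for p
    proof -
      have "p \<noteq> []" using that \<open>x \<noteq> w\<close> by (auto simp: awalk_Nil_iff)
      moreover have "p \<noteq> [e]" for e
        using that False by (cases e) (auto simp: awalk_Cons_iff awalk_Nil_iff)
      ultimately have "2 \<le> length p" by (cases p; cases "tl p") auto
      then show ?thesis by simp
    qed
    then have "2 \<le> graph_dist ?G x w" unfolding dist by (intro INF_greatest) auto
    ultimately show ?thesis using False by auto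
  qed
qed

text \<open>Think of \<open>U\<close> as rooks on a grid: some free square is attacked by all of them. Two rooks in
  general position span a rectangle, and one of its other corners works. Two rooks on a
  common line attack every free square of that line, and a line has at least three squares.\<close>

lemma two_points_blocked:
  fixes U :: "(nat \<times> nat) set"
  assumes "3 \<le> n1" "3 \<le> n2" and "U \<subseteq> {1..n1} \<times> {1..n2}" and "card U \<le> 2"
  obtains a b where "a \<in> {1..n1}" "b \<in> {1..n2}" "(a, b) \<notin> U"
    and "\<And>p q. (p, q) \<in> U \<Longrightarrow> p = a \<or> q = b"
proof -
  have "finite U" using assms(3) finite_subset by blast
  \<comment> \<open>Padding to two points of the grid, possibly equal, covers all sizes of \<open>U\<close> at once.\<close>
  have "\<exists>u v. U \<subseteq> {u, v} \<and> u \<in> {1..n1} \<times> {1..n2} \<and> v \<in> {1..n1} \<times> {1..n2}"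
  proof -
    consider "card U = 0" | "card U = 1" | "card U = 2" using assms(4) by linarith
    then show ?thesis
    proof cases
      case 1
      then have "U \<subseteq> {(1, 1), (1, 1)}" using \<open>finite U\<close> by simp
      moreover have "(1, 1) \<in> {1..n1} \<times> {1..n2}" using assms(1,2) by auto
      ultimately show ?thesis by blast
    next
      case 2
      then show ?thesis using assms(3) by (metis card_1_singletonE insert_subset insert_absorb2 order_refl)
    next
      case 3
      then show ?thesis using assms(3) by (metis card_2_iff insert_subset order_refl)
    qed
  qed
  then obtain u v where uv: "U \<subseteq> {u, v}" "u \<in> {1..n1} \<times> {1..n2}" "v \<in> {1..n1} \<times> {1..n2}"
    by blast
  obtain p q p' q' where "u = (p, q)" "v = (p', q')" by (cases u, cases v) auto
  then have U: "U \<subseteq> {(p, q), (p', q')}"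
    and box: "p \<in> {1..n1}" "q \<in> {1..n2}" "p' \<in> {1..n1}" "q' \<in> {1..n2}"
    using uv by simp_all
  obtain a where a: "a \<in> {1..n1}" "a \<noteq> p" "a \<noteq> p'" using avoid_two[OF assms(1)] .
  obtain b where b: "b \<in> {1..n2}" "b \<noteq> q" "b \<noteq> q'" using avoid_two[OF assms(2)] .
  consider "p = p'" | "q = q'" | "p \<noteq> p'" "q \<noteq> q'" by blast
  then show thesis
  proof cases
    case 1
    show thesis using U box b 1 by (intro that[of p b]) auto
  next
    case 2
    show thesis using U box a 2 by (intro that[of a q]) auto
  next
    case 3
    show thesis using U box 3 by (intro that[of p q']) auto
  qed
qed

definition layer :: "('a \<times> 'b \<times> 'c) set \<Rightarrow> 'c \<Rightarrow> ('a \<times> 'b \<times> 'c) set" where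
  "layer W c = {w \<in> W. snd (snd w) = c}"

text \<open>For landmarks in these two layers, being adjacent to one of \<open>(a, b, c)\<close> and \<open>(a, b, d)\<close>
  requires differing from \<open>(a, b)\<close> in both coordinates. With at most two of them, \<open>(a, b)\<close> can be
  chosen so that this never happens.\<close>

lemma two_layers_card_ge_3:
  assumes n: "3 \<le> n1" "3 \<le> n2" "3 \<le> n3"
    and res: "resolving_set (with_proj (HG3 n1 n2 n3)) W"
    and c: "c \<in> {1..n3}" "d \<in> {1..n3}" "c \<noteq> d"
  shows "3 \<le> card (layer W c) + card (layer W d)"
proof (rule ccontr)
  assume few: "\<not> ?thesis"
  let ?V = "pverts (HG3 n1 n2 n3)"
  let ?L = "layer W c \<union> layer W d"
  let ?U = "(\<lambda>(p, q, r). (p, q)) ` ?L"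
  have WV: "W \<subseteq> ?V" using res by (simp add: resolving_set_def)
  then have box: "W \<subseteq> {1..n1} \<times> {1..n2} \<times> {1..n3}" by (simp add: HG3_def)
  then have "finite ?L" by (auto simp: layer_def intro: finite_subset)
  then have "card ?U \<le> card ?L" by (rule card_image_le)
  also have "\<dots> \<le> card (layer W c) + card (layer W d)" by (rule card_Un_le)
  finally have U2: "card ?U \<le> 2" using few by simp
  have U_box: "?U \<subseteq> {1..n1} \<times> {1..n2}" using box by (auto simp: layer_def)
  obtain a b where ab: "a \<in> {1..n1}" "b \<in> {1..n2}" "(a, b) \<notin> ?U"
    and blocked: "\<And>p q. (p, q) \<in> ?U \<Longrightarrow> p = a \<or> q = b"
    using two_points_blocked[OF n(1,2) U_box U2] by blast
  let ?x = "(a, b, c)" and ?y = "(a, b, d)"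
  have V: "?x \<in> ?V" "?y \<in> ?V" using ab c by (auto simp: HG3_def)
  have proj: "(p, q) \<in> ?U" if "(p, q, r) \<in> ?L" for p q r
    using that by (rule rev_image_eqI) simp
  have "?x \<notin> ?L" "?y \<notin> ?L" using ab(3) proj by blast+
  then have "?x \<notin> W" "?y \<notin> W" by (simp_all add: layer_def)
  then have "?x \<in> ?V - W" "?y \<in> ?V - W" "?x \<noteq> ?y" using V c(3) by auto
  then obtain w where w: "w \<in> W"
    and sep: "graph_dist (with_proj (HG3 n1 n2 n3)) ?x w \<noteq> graph_dist (with_proj (HG3 n1 n2 n3)) ?y w"
    using res unfolding resolving_set_def with_proj_simps by blast
  obtain p q r where pqr: "w = (p, q, r)" by (metis prod_cases3)
  have "w \<in> ?V" using w WV by blast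
  have "p = a \<or> q = b" if "r = c \<or> r = d"
  proof -
    have "(p, q, r) \<in> ?L" using w that by (auto simp: layer_def pqr)
    then show ?thesis by (rule blocked[OF proj])
  qed
  then have "(?x, w) \<in> parcs (HG3 n1 n2 n3) \<longleftrightarrow> (?y, w) \<in> parcs (HG3 n1 n2 n3)"
    using V \<open>w \<in> ?V\<close> by (auto simp: HG3_def pqr)
  moreover have "?x \<noteq> w" "?y \<noteq> w" using w \<open>?x \<notin> W\<close> \<open>?y \<notin> W\<close> by auto
  ultimately show False
    using sep V \<open>w \<in> ?V\<close> by (simp add: HG3_graph_dist[OF n])
qed

text \<open>If some \<open>c\<close> has \<open>f c \<le> 1\<close>, the other values are at least \<open>3 - f c\<close>: for \<open>f c = 1\<close> this
  gives \<open>1 + 2 (n - 1) = 2 n - 1\<close> with \<open>n = card A\<close>, and for \<open>f c = 0\<close> it gives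
  \<open>3 (n - 1)\<close>, which is at least \<open>2 n - 1\<close> as soon as \<open>n \<ge> 2\<close>.\<close>

lemma sum_ge_if_pairs_ge_3:
  fixes f :: "'a \<Rightarrow> nat"
  assumes "finite A" "2 \<le> card A"
    and pairs: "\<And>c d. c \<in> A \<Longrightarrow> d \<in> A \<Longrightarrow> c \<noteq> d \<Longrightarrow> 3 \<le> f c + f d"
  shows "2 * card A - 1 \<le> sum f A"
proof (cases "\<forall>c\<in>A. 2 \<le> f c")
  case True
  then have "card A * 2 \<le> sum f A" using sum_bounded_below[of A 2 f] by simp
  then show ?thesis by simp
next
  case False
  then obtain c where c: "c \<in> A" "f c \<le> 1" by force
  have "card (A - {c}) * (3 - f c) \<le> sum f (A - {c})"
  proof -
    have "3 - f c \<le> f d" if "d \<in> A - {c}" for d using pairs[of c d] that c(1) by auto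
    then show ?thesis using sum_bounded_below[of "A - {c}" "3 - f c" f] by simp
  qed
  moreover have "sum f A = f c + sum f (A - {c})" using c(1) assms(1) by (rule sum.remove[rotated])
  moreover have "card (A - {c}) = card A - 1" using c(1) by (rule card_Diff_singleton)
  moreover have "f c = 0 \<or> f c = 1" using c(2) by auto
  ultimately show ?thesis using assms(2) by auto
qed

theorem theorem2p2:
  fixes n1 n2 n3 :: nat and W :: "(nat \<times> nat \<times> nat) set"
  assumes "3 \<le> n1" and "n1 \<le> n2" and "n2 \<le> n3"
    and "resolving_set (with_proj (HG3 n1 n2 n3)) W"
  shows "card W \<ge> 2 * n3 - 1"
proof -
  have box: "W \<subseteq> {1..n1} \<times> {1..n2} \<times> {1..n3}"
    using assms(4) by (simp add: resolving_set_def HG3_def)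
  then have "finite W" by (rule finite_subset) simp
  then have "card W = (\<Sum>c\<in>{1..n3}. card (layer W c))"
    using box sum.group[of W "{1..n3}" "\<lambda>w. snd (snd w)" "\<lambda>_. 1::nat"]
    by (force simp: layer_def)
  moreover have "2 * card {1..n3} - 1 \<le> (\<Sum>c\<in>{1..n3}. card (layer W c))"
  proof (rule sum_ge_if_pairs_ge_3)
    show "3 \<le> card (layer W c) + card (layer W d)"
      if "c \<in> {1..n3}" "d \<in> {1..n3}" "c \<noteq> d" for c d
      by (rule two_layers_card_ge_3[OF _ _ _ assms(4) that]) (use assms(1-3) in simp_all)
  qed (use assms(1-3) in auto)
  ultimately show ?thesis by simp
qed

end
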